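(* $N(63) \ge 8$; that is, there exist $8$ mutually orthogonal Latin squares of order $63$.
   Context: A Latin square of order $n$ on an $n$-element set $V$ is an $n\times n$ matrix every row and every column of which is a permutation of $V$. Two Latin squares $L_1=(v_{ij})$ and $L_2=(w_{ij})$ of order $n$ (on symbol sets $V$, $W$ of size $n$) are orthogonal if the $n^2$ pairs $(v_{ij},w_{ij})$ are all distinct, i.e. they exhaust $V\times W$. A set of Latin squares is a set of mutually orthogonal Latin squares (MOLS) if any two of them are orthogonal. $N(n)$ denotes the largest size of a set of MOLS of order $n$. *)

theory Defs
  imports "Jordan_Normal_Form.Matrix" "HOL-Library.Extended_Nat"
begin

definition latin_square :: "nat \<Rightarrow> 'a set \<Rightarrow> 'a mat \<Rightarrow> bool" where
  "latin_square n V L \<longleftrightarrow>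
     finite V \<and> card V = n \<and> L \<in> carrier_mat n n \<and>
     (\<forall>i<n. bij_betw (\<lambda>j. L $$ (i, j)) {..<n} V) \<and>
     (\<forall>j<n. bij_betw (\<lambda>i. L $$ (i, j)) {..<n} V)"

definition latin_orthogonal :: "nat \<Rightarrow> 'a mat \<Rightarrow> 'b mat \<Rightarrow> bool" where
  "latin_orthogonal n L M \<longleftrightarrow>
     inj_on (\<lambda>(i, j). (L $$ (i, j), M $$ (i, j))) ({..<n} \<times> {..<n})"

text \<open>Different members of a set of MOLS may have different symbol sets.\<close>

definition mols :: "nat \<Rightarrow> 'a mat set \<Rightarrow> bool" where
  "mols n S \<longleftrightarrow>
     (\<forall>L\<in>S. \<exists>V. latin_square n V L) \<and> pairwise (latin_orthogonal n) S"

text \<open>Symbols are taken from \<^typ>\<open>nat\<close>, which contains a copy of every finite symbol set.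
  The value is an extended natural number because in order 1 there are arbitrarily large sets
  of MOLS (on different symbol sets).\<close>

definition mols_number :: "nat \<Rightarrow> enat" where
  "mols_number n = Sup {enat (card S) | S :: nat mat set. finite S \<and> mols n S}"

lemma mols_subset: "mols n S \<Longrightarrow> T \<subseteq> S \<Longrightarrow> mols n T"
  unfolding mols_def by (blast intro: pairwise_subset)

text \<open>The supremum is attained whenever it is finite, so it is the largest size of a set of MOLS.\<close>

lemma le_mols_number_iff:
  "enat k \<le> mols_number n \<longleftrightarrow> (\<exists>S :: nat mat set. finite S \<and> mols n S \<and> card S = k)"
proof
  assume le: "enat k \<le> mols_number n"
  show "\<exists>S :: nat mat set. finite S \<and> mols n S \<and> card S = k"
  proof (cases k)
    case 0
    then show ?thesis by (intro exI[of _ "{}"]) (simp add: mols_def)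
  next
    case (Suc m)
    then have "enat m < mols_number n"
      using le by (metis enat_ord_simps(2) lessI order_less_le_trans)
    then obtain S :: "nat mat set" where S: "finite S" "mols n S" "m < card S"
      unfolding mols_number_def less_Sup_iff by auto
    then obtain T where "T \<subseteq> S" "card T = k" "finite T"
      using Suc by (metis Suc_leI obtain_subset_with_card_n)
    then show ?thesis using S mols_subset by blast
  qed
next
  assume "\<exists>S :: nat mat set. finite S \<and> mols n S \<and> card S = k"
  then show "enat k \<le> mols_number n"
    unfolding mols_number_def by (intro Sup_upper) auto
qed

end

theory Submission
  imports Defs "HOL-Library.Numeral_Type" "HOL-Library.Product_Plus" "HOL-Number_Theory.Cong"
begin

text \<open>
  A difference matrix with \<open>k + 1\<close> rows over an abelian group of order \<open>n\<close> yields \<open>k\<close> MOLS of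
  order \<open>n\<close>. We use such a matrix with 9 rows over the group \<open>F\<^sub>9 \<times> F\<^sub>7\<close>, where
  \<open>F\<^sub>9 = F\<^sub>3(i)\<close>. Its rows are indexed by \<open>r \<in> F\<^sub>9\<close>, its columns by pairs of \<open>j < 7\<close> and
  \<open>x \<in> F\<^sub>9\<close>, and its entries are \<open>(a\<^sub>j(r) + x r, 2\<^bsup>Re x\<^esup> b\<^sub>j(r))\<close>. For fixed \<open>r \<noteq> s\<close> and \<open>j\<close>
  the differences of rows \<open>r\<close> and \<open>s\<close>, as \<open>x\<close> varies, are 9 distinct elements \<open>(\<alpha>, \<beta>)\<close> of
  \<open>F\<^sub>9 \<times> F\<^sub>7\<close> with the same value of \<open>2\<^bsup>- Re (\<alpha> / (r - s))\<^esup> \<beta>\<close>. So it suffices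
  that for every pair \<open>r \<noteq> s\<close> these values are distinct for the 7 choices of \<open>j\<close>. Functions \<open>a\<^sub>j\<close>,
  \<open>b\<^sub>j\<close> with this property were found by a computer search in which the map
  \<open>(r, a, b) \<mapsto> (- r, - a, b)\<close> was required to permute the 7 columns.
\<close>

lemma mols_of_difference_matrix:
  fixes D :: "nat \<Rightarrow> nat \<Rightarrow> 'g::{ab_group_add, finite}"
  assumes n: "CARD('g) = n" "2 \<le> n"
    and D: "\<And>r s. s < r \<Longrightarrow> r \<le> k \<Longrightarrow> inj_on (\<lambda>c. D r c - D s c) {..<n}"
  shows "\<exists>S :: nat mat set. finite S \<and> mols n S \<and> card S = k"
proof -
  obtain e :: "'g \<Rightarrow> nat" where e: "bij_betw e UNIV {..<n}"
    using ex_bij_betw_finite_nat[of "UNIV :: 'g set"] n(1) by (auto simp: atLeast0LessThan)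
  define d where "d = inv_into UNIV e"
  have d: "bij_betw d {..<n} UNIV"
    unfolding d_def using e by (rule bij_betw_inv_into)
  have e_eq: "e x = e y \<longleftrightarrow> x = y" for x y
    using e by (meson bij_betw_imp_inj_on inj_eq)
  have e_less: "e x < n" for x
    using e by (auto simp: bij_betw_def)
  have d_eq: "d i = d j \<longleftrightarrow> i = j" if "i < n" "j < n" for i j
    using that d by (auto simp: bij_betw_def inj_on_def)
  have diff: "c = c'"
    if "D r c - D s c = D r c' - D s c'" "r \<noteq> s" "r \<le> k" "s \<le> k" "c < n" "c' < n" for r s c c'
  proof (cases "s < r")
    case True
    then show ?thesis using D[of s r] that by (auto simp: inj_on_def)
  next
    case False
    then have "s > r" using that by simp
    moreover have "D s c - D r c = D s c' - D r c'"
      using that(1) by (metis minus_diff_eq)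
    ultimately show ?thesis using D[of r s] that by (auto simp: inj_on_def)
  qed
  \<comment> \<open>Subtracting row 0 makes the columns of \<open>L r\<close> injective. In the
    difference of two squares \<open>D 0 c\<close> and \<open>d g\<close> cancel, which gives
    orthogonality.\<close>
  define L where "L r = mat n n (\<lambda>(c, g). e (D r c - D 0 c + d g))" for r
  have L: "L r $$ (c, g) = e (D r c - D 0 c + d g)" if "c < n" "g < n" for r c g
    using that by (simp add: L_def)
  have bij: "bij_betw f {..<n} {..<n}"
    if "inj_on f {..<n}" "f ` {..<n} \<subseteq> {..<n}" for f :: "nat \<Rightarrow> nat"
    using that by (simp add: bij_betw_def endo_inj_surj)
  have latin: "latin_square n {..<n} (L r)" if "r \<in> {1..k}" for r
    unfolding latin_square_def
  proof (intro conjI allI impI)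
    show "L r \<in> carrier_mat n n" by (simp add: L_def)
    show "bij_betw (\<lambda>j. L r $$ (i, j)) {..<n} {..<n}" if "i < n" for i
      using that by (intro bij) (auto simp: inj_on_def L e_eq e_less d_eq)
    show "bij_betw (\<lambda>i. L r $$ (i, j)) {..<n} {..<n}" if "j < n" for j
      using that \<open>r \<in> {1..k}\<close>
      by (intro bij) (auto simp: inj_on_def L e_eq e_less intro: diff[of r _ 0])
  qed auto
  have orth: "latin_orthogonal n (L r) (L s)" if "r \<in> {1..k}" "s \<in> {1..k}" "r \<noteq> s" for r s
    unfolding latin_orthogonal_def
  proof (rule inj_onI, clarify)
    fix i j i' j'
    assume less: "i < n" "j < n" "i' < n" "j' < n"
      and "L r $$ (i, j) = L r $$ (i', j')" "L s $$ (i, j) = L s $$ (i', j')"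
    then have eq: "D r i - D 0 i + d j = D r i' - D 0 i' + d j'"
      "D s i - D 0 i + d j = D s i' - D 0 i' + d j'"
      by (auto simp: L e_eq)
    have "D r i - D s i = (D r i - D 0 i + d j) - (D s i - D 0 i + d j)" by simp
    also have "\<dots> = D r i' - D s i'" unfolding eq by simp
    finally have "i = i'" using that less by (intro diff[of r i s i']) auto
    with eq less show "i = i' \<and> j = j'" by (simp add: d_eq)
  qed
  have "inj_on L {1..k}"
  proof (rule inj_onI, rule ccontr)
    fix r s assume rs: "r \<in> {1..k}" "s \<in> {1..k}" "L r = L s" "r \<noteq> s"
    have "D r c = D s c" if "c < n" for c
      using rs(3) L[of c c r] L[of c c s] that by (simp add: e_eq)
    \<comment> \<open>The difference of rows \<open>r\<close> and \<open>s\<close> would vanish in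
      both columns 0 and 1.\<close>
    then have "0 = (1 :: nat)"
      using n(2) rs by (intro diff[of r 0 s 1]) auto
    then show False by simp
  qed
  then have "card (L ` {1..k}) = k" by (simp add: card_image)
  moreover have "mols n (L ` {1..k})"
    unfolding mols_def pairwise_def using latin orth by blast
  ultimately show ?thesis by blast
qed

text \<open>Entry \<open>j\<close> of row \<open>p + 3 q\<close> is \<open>(Re a, Im a, b)\<close> for \<open>a = a\<^sub>j(p + q i)\<close> and
  \<open>b = b\<^sub>j(p + q i)\<close>.\<close>

definition base_table :: "(int \<times> int \<times> int) list list" where
  "base_table =
    [[(0,0,0), (0,0,0), (0,0,0), (0,0,0), (0,0,0), (0,0,0), (0,0,0)],
     [(0,0,6), (0,0,3), (0,0,5), (0,1,0), (0,0,2), (0,2,1), (0,0,4)],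
     [(0,0,3), (0,0,6), (0,2,0), (0,0,5), (0,1,1), (0,0,2), (0,0,4)],
     [(0,0,2), (2,0,5), (2,0,4), (1,2,0), (0,0,1), (1,1,5), (1,1,6)],
     [(0,0,3), (0,1,2), (0,2,2), (0,2,0), (0,1,6), (2,0,4), (1,0,3)],
     [(0,0,1), (1,2,0), (1,1,4), (2,1,5), (0,0,3), (0,1,1), (1,0,3)],
     [(1,0,5), (0,0,2), (2,1,0), (1,0,4), (2,2,5), (0,0,1), (2,2,6)],
     [(2,1,0), (0,0,1), (1,2,5), (2,2,4), (0,2,1), (0,0,3), (2,0,3)],
     [(0,2,2), (0,0,3), (0,1,0), (0,1,2), (1,0,4), (0,2,6), (2,0,3)]]"

text \<open>Column \<open>u + 3 v + 9 j\<close> is the one with index \<open>j\<close> and \<open>x = u + v i\<close>.\<close>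

definition entry :: "nat \<Rightarrow> nat \<Rightarrow> int \<times> int \<times> int" where
  "entry r c =
    (let p = int (r mod 3); q = int (r div 3);
         u = int (c mod 3); v = int (c div 3 mod 3);
         (a1, a2, b) = base_table ! r ! (c div 9)
     in (a1 + u * p - v * q, a2 + u * q + v * p, 2 ^ (c mod 3) * b))"

definition row_difference :: "nat \<Rightarrow> nat \<Rightarrow> nat \<Rightarrow> int \<times> int \<times> int" where
  "row_difference r s c =
    (let (x, y, z) = entry r c; (x', y', z') = entry s c
     in ((x - x') mod 3, (y - y') mod 3, (z - z') mod 7))"

lemma distinct_row_differences:
  "\<forall>r\<in>set [0..<9]. \<forall>s\<in>set [0..<r]. distinct (map (row_difference r s) [0..<63])"
  by code_simp

text \<open>Only differences are compared, so the additive group of F_9 suffices, as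
  \<open>3 \<times> 3\<close>.\<close>

definition embed :: "int \<times> int \<times> int \<Rightarrow> 3 \<times> 3 \<times> 7" where
  "embed = (\<lambda>(x, y, z). (of_int x, of_int y, of_int z))"

lemma of_int_mod3_eq_iff: "(of_int x :: 3) = of_int y \<longleftrightarrow> x mod 3 = y mod 3"
  by (simp add: of_int_eq_iff_cong_CHAR cong_def)

lemma of_int_mod7_eq_iff: "(of_int x :: 7) = of_int y \<longleftrightarrow> x mod 7 = y mod 7"
  by (simp add: of_int_eq_iff_cong_CHAR cong_def)

text \<open>This carries the check on integer residues over to the group.\<close>

lemma embed_diff_eq_iff:
  "embed (entry r c) - embed (entry s c) = embed (entry r c') - embed (entry s c') \<longleftrightarrow>
   row_difference r s c = row_difference r s c'"
  unfolding embed_def row_difference_def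
  by (simp add: case_prod_beta of_int_mod3_eq_iff of_int_mod7_eq_iff flip: of_int_diff)

lemma inj_on_embed_diff:
  assumes "s < r" "r \<le> 8"
  shows "inj_on (\<lambda>c. embed (entry r c) - embed (entry s c)) {..<63}"
proof -
  have "distinct (map (row_difference r s) [0..<63])"
    using distinct_row_differences assms by auto
  then have "inj_on (row_difference r s) {..<63}"
    by (simp add: distinct_map atLeast0LessThan)
  then show ?thesis
    by (simp add: inj_on_def embed_diff_eq_iff)
qed

theorem theorem4:
  "mols_number 63 \<ge> 8 \<and> (\<exists>S :: nat mat set. mols 63 S \<and> card S = 8)"
proof -
  have "\<exists>S :: nat mat set. finite S \<and> mols 63 S \<and> card S = 8"
    by (rule mols_of_difference_matrix[where D = "\<lambda>r c. embed (entry r c)"])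
      (simp_all add: inj_on_embed_diff)
  moreover from this have "enat 8 \<le> mols_number 63"
    by (simp only: le_mols_number_iff)
  ultimately show ?thesis
    by (auto simp: numeral_eq_enat)
qed

end
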